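(* Let $D \subset \mathbb{C}$ be a finitely connected bounded domain bounded by Jordan curves, and let $p \in \partial D$ be a $C^2$-smooth boundary point. Then $\sqrt{s_D(z)} \approx 1/\operatorname{dist}(z, \partial D)$ for $z \in D$ close to $p$; that is, there exist a constant $C > 1$ and a neighbourhood $V$ of $p$ such that $$\frac{1}{C}\,\frac{1}{\operatorname{dist}(z,\partial D)} \le \sqrt{s_D(z)} \le C\,\frac{1}{\operatorname{dist}(z,\partial D)} \qquad \text{for all } z \in V \cap D.$$
   Context: A finitely connected domain bounded by Jordan curves is a domain (connected open set) in $\mathbb{C}$ whose boundary is the union of finitely many pairwise disjoint Jordan curves (simple closed curves). A point $p \in \partial D$ is a $C^2$-smooth boundary point if there are an open neighbourhood $U$ of $p$ and a real-valued $\psi \in C^2(U)$ with $U \cap D = \{\psi < 0\}$, $U \cap \partial D = \{\psi = 0\}$ and $d\psi \neq 0$ on $U \cap \partial D$. Span metric: for a domain $D \subset \mathbb{C}$ and $\zeta \in D$, $$s_D(\zeta) := \sup\left\{ |f'(\zeta)|^2 : f \text{ holomorphic on } D,\ \int_D |f'(z)|^2\, dA(z) \le \pi \right\},$$ where $dA$ is planar Lebesgue measure. The span metric is the conformal metric $s_D(z)|dz|^2$. $\operatorname{dist}(z,\partial D)$ is the Euclidean distance from $z$ to $\partial D$. *)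

theory Defs
  imports "HOL-Analysis.Analysis"
begin

definition jordan_curve :: "complex set \<Rightarrow> bool" where
  "jordan_curve J \<longleftrightarrow> (\<exists>g. simple_path g \<and> pathfinish g = pathstart g \<and> path_image g = J)"

definition domain_bounded_by_jordan_curves :: "complex set \<Rightarrow> bool" where
  "domain_bounded_by_jordan_curves D \<longleftrightarrow>
     open D \<and> connected D \<and> D \<noteq> {} \<and>
     (\<exists>\<J>. finite \<J> \<and> (\<forall>J\<in>\<J>. jordan_curve J) \<and> pairwise disjnt \<J> \<and> frontier D = \<Union>\<J>)"

(* Real differentiability of class C^2, with the plane regarded as a real vector space:
   D1 and D2 are the first and second Frechet derivatives.  Meant for open U. *)
definition C2_on :: "complex set \<Rightarrow> (complex \<Rightarrow> real) \<Rightarrow> bool" where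
  "C2_on U \<psi> \<longleftrightarrow>
     (\<exists>(D1 :: complex \<Rightarrow> (complex \<Rightarrow>\<^sub>L real)) (D2 :: complex \<Rightarrow> (complex \<Rightarrow>\<^sub>L complex \<Rightarrow>\<^sub>L real)).
        (\<forall>z\<in>U. (\<psi> has_derivative blinfun_apply (D1 z)) (at z)) \<and>
        (\<forall>z\<in>U. (D1 has_derivative blinfun_apply (D2 z)) (at z)) \<and>
        continuous_on U D2)"

definition C2_smooth_boundary_point :: "complex set \<Rightarrow> complex \<Rightarrow> bool" where
  "C2_smooth_boundary_point D p \<longleftrightarrow>
     p \<in> frontier D \<and>
     (\<exists>U \<psi>. open U \<and> p \<in> U \<and> C2_on U \<psi> \<and>
        U \<inter> D = {z \<in> U. \<psi> z < 0} \<and>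
        U \<inter> frontier D = {z \<in> U. \<psi> z = 0} \<and>
        (\<forall>z \<in> U \<inter> frontier D. frechet_derivative \<psi> (at z) \<noteq> (\<lambda>_. 0)))"

(* The density of the span metric.  The energy is an extended nonnegative integral, so functions
   of infinite energy are not admissible.  For open D and \<zeta> in D the set below contains 0
   and is bounded above (mean value property), so the real-valued supremum is the true one. *)
definition span_metric :: "complex set \<Rightarrow> complex \<Rightarrow> real" where
  "span_metric D \<zeta> =
     Sup {(cmod (deriv f \<zeta>))\<^sup>2 | f.
            f holomorphic_on D \<and>
            (\<integral>\<^sup>+z\<in>D. ennreal ((cmod (deriv f z))\<^sup>2) \<partial>lborel) \<le> ennreal pi}"

end

theory Submission
  imports Defs "HOL-Complex_Analysis.Complex_Analysis"
begin

text \<open>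
  Upper bound: the area mean value inequality for \<open>(f')\<^sup>2\<close> on the disc of radius
  \<open>d = dist(z, \<partial>D)\<close> gives \<open>\<pi> d\<^sup>2 |f'(z)|\<^sup>2 \<le> \<pi>\<close>.
  Lower bound: let \<open>q\<close> be a boundary point nearest to \<open>z\<close>. Moving from \<open>q\<close> by \<open>d\<close> in a fixed outward
  direction one reaches a point \<open>b\<close> with \<open>|z - b| \<le> 2 d\<close> such that the disc of radius \<open>\<rho> = c d\<close>
  about \<open>b\<close> misses \<open>D\<close>, where \<open>c\<close> depends only on \<open>p\<close>. The function \<open>w \<mapsto> (\<rho> / 4) / (w - b)\<close> has
  energy at most \<open>\<pi>\<close> outside this disc, and its derivative at \<open>z\<close> is of order \<open>1 / d\<close>.
\<close>

section \<open>Rotation invariance of planar Lebesgue measure\<close>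

text \<open>Lebesgue measure is determined by its values on boxes, and the preimage of a box under
  \<open>Complex\<close> is a product of two intervals. This identification carries Tonelli's
  theorem over to the complex plane.\<close>

lemma lborel_complex_eq_distr:
  "(lborel :: complex measure) = distr (lborel \<Otimes>\<^sub>M lborel) borel (\<lambda>(x, y). Complex x y)"
proof (rule lborel_eqI)
  have meas: "(\<lambda>(x, y). Complex x y) \<in> borel_measurable (borel \<Otimes>\<^sub>M borel)"
    by (auto simp: borel_prod case_prod_unfold Complex_eq intro!: borel_measurable_continuous_onI continuous_intros)
  fix l u :: complex
  assume le: "\<And>b. b \<in> Basis \<Longrightarrow> l \<bullet> b \<le> u \<bullet> b"
  from le[of 1] le[of \<i>] have lu: "Re l \<le> Re u" "Im l \<le> Im u"
    by (auto simp: Basis_complex_def)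
  have "(\<lambda>(x, y). Complex x y) -` box l u = {Re l<..<Re u} \<times> {Im l<..<Im u}"
    by (auto simp: box_def Basis_complex_def)
  then have "emeasure (distr (lborel \<Otimes>\<^sub>M lborel) borel (\<lambda>(x, y). Complex x y)) (box l u)
      = emeasure (lborel \<Otimes>\<^sub>M lborel) ({Re l<..<Re u} \<times> {Im l<..<Im u})"
    using meas by (subst emeasure_distr) (auto simp: space_pair_measure)
  also have "\<dots> = ennreal ((Re u - Re l) * (Im u - Im l))"
    using lu by (subst lborel.emeasure_pair_measure_Times) (auto simp: ennreal_mult)
  also have "(Re u - Re l) * (Im u - Im l) = (\<Prod>b\<in>Basis. (u - l) \<bullet> b)"
    by (simp add: Basis_complex_def)
  finally show "emeasure (distr (lborel \<Otimes>\<^sub>M lborel) borel (\<lambda>(x, y). Complex x y)) (box l u)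
      = (\<Prod>b\<in>Basis. (u - l) \<bullet> b)" .
qed simp

lemma measurable_Complex [measurable]:
  "(\<lambda>(x, y). Complex x y) \<in> borel_measurable (lborel \<Otimes>\<^sub>M lborel)"
  by (auto simp: lborel_prod case_prod_unfold Complex_eq
      intro!: borel_measurable_continuous_onI continuous_intros)

text \<open>Both orders of integration are recorded because a shear acts by translations along one
  axis only: the horizontal shear needs \<open>x\<close> as inner variable, the vertical one needs
  \<open>y\<close>.\<close>

lemma nn_integral_complex_iterated:
  assumes [measurable]: "f \<in> borel_measurable borel"
  shows "(\<integral>\<^sup>+z. f z \<partial>lborel) = (\<integral>\<^sup>+x. (\<integral>\<^sup>+y. f (Complex x y) \<partial>lborel) \<partial>lborel)"
    and "(\<integral>\<^sup>+z. f z \<partial>lborel) = (\<integral>\<^sup>+y. (\<integral>\<^sup>+x. f (Complex x y) \<partial>lborel) \<partial>lborel)"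
proof -
  have meas: "(\<lambda>(x, y). f (Complex x y)) \<in> borel_measurable (lborel \<Otimes>\<^sub>M lborel)"
    using measurable_compose[OF measurable_Complex assms] by (simp add: case_prod_unfold)
  have "(\<integral>\<^sup>+z. f z \<partial>lborel) = (\<integral>\<^sup>+p. f (case p of (x, y) \<Rightarrow> Complex x y) \<partial>(lborel \<Otimes>\<^sub>M lborel))"
    by (subst lborel_complex_eq_distr) (rule nn_integral_distr, auto)
  then have eq: "(\<integral>\<^sup>+z. f z \<partial>lborel) = (\<integral>\<^sup>+p. (case p of (x, y) \<Rightarrow> f (Complex x y)) \<partial>(lborel \<Otimes>\<^sub>M lborel))"
    by (simp add: case_prod_unfold)
  show "(\<integral>\<^sup>+z. f z \<partial>lborel) = (\<integral>\<^sup>+x. (\<integral>\<^sup>+y. f (Complex x y) \<partial>lborel) \<partial>lborel)"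
    using lborel.nn_integral_fst[OF meas] eq by simp
  show "(\<integral>\<^sup>+z. f z \<partial>lborel) = (\<integral>\<^sup>+y. (\<integral>\<^sup>+x. f (Complex x y) \<partial>lborel) \<partial>lborel)"
    using lborel_pair.nn_integral_snd[OF meas] eq by simp
qed

lemma nn_integral_real_translation:
  fixes f :: "real \<Rightarrow> ennreal"
  assumes "f \<in> borel_measurable borel"
  shows "(\<integral>\<^sup>+x. f (x + t) \<partial>lborel) = (\<integral>\<^sup>+x. f x \<partial>lborel)"
  using nn_integral_real_affine[OF assms, of 1 t] by (simp add: add.commute)

text \<open>On the line of height \<open>y\<close> the shear is the translation by
  \<open>a * y\<close>, which leaves the inner integral unchanged.\<close>

lemma nn_integral_horizontal_shear:
  assumes [measurable]: "f \<in> borel_measurable borel"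
  shows "(\<integral>\<^sup>+z. f (z + of_real (a * Im z)) \<partial>lborel) = (\<integral>\<^sup>+z. f z \<partial>lborel)"
proof -
  have [measurable]: "(\<lambda>z. f (z + of_real (a * Im z))) \<in> borel_measurable borel"
    by (rule measurable_compose[OF _ assms])
      (auto intro!: borel_measurable_continuous_onI continuous_intros)
  have "(\<lambda>x. f (Complex x y)) \<in> borel_measurable borel" for y
    by (rule measurable_compose[OF _ assms])
      (auto simp: Complex_eq intro!: borel_measurable_continuous_onI continuous_intros)
  then have "(\<integral>\<^sup>+x. f (Complex (x + a * y) y) \<partial>lborel) = (\<integral>\<^sup>+x. f (Complex x y) \<partial>lborel)" for y
    by (rule nn_integral_real_translation)
  moreover have "Complex x y + complex_of_real (a * Im (Complex x y)) = Complex (x + a * y) y" for x y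
    by (simp add: complex_eq_iff)
  ultimately show ?thesis
    by (simp add: nn_integral_complex_iterated(2))
qed

lemma nn_integral_vertical_shear:
  assumes [measurable]: "f \<in> borel_measurable borel"
  shows "(\<integral>\<^sup>+z. f (z + \<i> * of_real (a * Re z)) \<partial>lborel) = (\<integral>\<^sup>+z. f z \<partial>lborel)"
proof -
  have [measurable]: "(\<lambda>z. f (z + \<i> * of_real (a * Re z))) \<in> borel_measurable borel"
    by (rule measurable_compose[OF _ assms])
      (auto intro!: borel_measurable_continuous_onI continuous_intros)
  have "(\<lambda>y. f (Complex x y)) \<in> borel_measurable borel" for x
    by (rule measurable_compose[OF _ assms])
      (auto simp: Complex_eq intro!: borel_measurable_continuous_onI continuous_intros)
  then have "(\<integral>\<^sup>+y. f (Complex x (y + a * x)) \<partial>lborel) = (\<integral>\<^sup>+y. f (Complex x y) \<partial>lborel)" for x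
    by (rule nn_integral_real_translation)
  moreover have "Complex x y + \<i> * complex_of_real (a * Re (Complex x y)) = Complex x (y + a * x)" for x y
    by (simp add: complex_eq_iff)
  ultimately show ?thesis
    by (simp add: nn_integral_complex_iterated(1))
qed

lemma nn_integral_rotation:
  assumes f: "f \<in> borel_measurable borel" and c: "cmod c = 1"
  shows "(\<integral>\<^sup>+z. f (c * z) \<partial>lborel) = (\<integral>\<^sup>+z. f z \<partial>lborel)"
proof -
  \<comment> \<open>A rotation by an angle other than \<open>\<pi>\<close> is a product of three shears.\<close>
  have main: "(\<integral>\<^sup>+z. f (c * z) \<partial>lborel) = (\<integral>\<^sup>+z. f z \<partial>lborel)"
    if f: "f \<in> borel_measurable borel" and c: "cmod c = 1" "c \<noteq> - 1" for f and c :: complex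
  proof -
    note [measurable] = f
    \<comment> \<open>For c = exp(i t) this is -tan(t/2), the classical coefficient of the two outer
      shears; the middle shear has coefficient sin t. The denominator vanishes only at c =
      -1.\<close>
    define a where "a = - Im c / (1 + Re c)"
    have sq: "(Re c)\<^sup>2 + (Im c)\<^sup>2 = 1"
      using c by (simp add: cmod_power2[symmetric])
    have nz: "1 + Re c \<noteq> 0"
    proof
      assume "1 + Re c = 0"
      then have "Re c = - 1" by simp
      with sq have "c = - 1" by (simp add: complex_eq_iff)
      with c show False by simp
    qed
    have a1: "a * Im c = Re c - 1"
    proof -
      have "a * Im c * (1 + Re c) = - (Im c)\<^sup>2"
        using nz by (simp add: a_def power2_eq_square)
      also have "\<dots> = (Re c - 1) * (1 + Re c)"
        using sq by (simp add: algebra_simps power2_eq_square)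
      finally show ?thesis using nz by simp
    qed
    have a2: "a + a * Re c = - Im c"
    proof -
      have "a * (1 + Re c) = - Im c" using nz by (simp add: a_def)
      then show ?thesis by (simp add: algebra_simps)
    qed
    define S where "S = (\<lambda>z. z + of_real (a * Im z) :: complex)"
    define T where "T = (\<lambda>z. z + \<i> * of_real (Im c * Re z) :: complex)"
    have [measurable]: "S \<in> borel_measurable borel" "T \<in> borel_measurable borel"
      unfolding S_def T_def by (auto intro!: borel_measurable_continuous_onI continuous_intros)
    have S: "(\<integral>\<^sup>+z. h (S z) \<partial>lborel) = (\<integral>\<^sup>+z. h z \<partial>lborel)"
      if "h \<in> borel_measurable borel" for h
      unfolding S_def by (rule nn_integral_horizontal_shear[OF that])
    have T: "(\<integral>\<^sup>+z. h (T z) \<partial>lborel) = (\<integral>\<^sup>+z. h z \<partial>lborel)"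
      if "h \<in> borel_measurable borel" for h
      unfolding T_def by (rule nn_integral_vertical_shear[OF that])
    have "c * z = S (T (S z))" for z
    proof (rule complex_eqI)
      have "Re (S (T (S z))) = Re z * (1 + a * Im c) + Im z * (a + a + a * (a * Im c))"
        by (simp add: S_def T_def algebra_simps)
      also have "a + a + a * (a * Im c) = - Im c"
        using a2 unfolding a1 by (simp add: algebra_simps)
      finally show "Re (c * z) = Re (S (T (S z)))" by (simp add: a1 algebra_simps)
      have "Im (S (T (S z))) = Im z * (1 + a * Im c) + Im c * Re z"
        by (simp add: S_def T_def algebra_simps)
      then show "Im (c * z) = Im (S (T (S z)))" by (simp add: a1 algebra_simps)
    qed
    then have "(\<integral>\<^sup>+z. f (c * z) \<partial>lborel) = (\<integral>\<^sup>+z. f (S (T (S z))) \<partial>lborel)" by simp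
    also have "\<dots> = (\<integral>\<^sup>+z. f (S (T z)) \<partial>lborel)"
      by (intro S) measurable
    also have "\<dots> = (\<integral>\<^sup>+z. f (S z) \<partial>lborel)"
      by (intro T) measurable
    also have "\<dots> = (\<integral>\<^sup>+z. f z \<partial>lborel)"
      using f by (rule S)
    finally show ?thesis .
  qed
  show ?thesis
  proof (cases "c = - 1")
    case True
    \<comment> \<open>The half turn is the composition of two quarter turns, and \<open>\<i>\<close>
      falls under the case already settled.\<close>
    have "(\<lambda>z. f (\<i> * z)) \<in> borel_measurable borel"
      by (rule measurable_compose[OF _ f])
        (auto intro!: borel_measurable_continuous_onI continuous_intros)
    then have "(\<integral>\<^sup>+z. f (\<i> * (\<i> * z)) \<partial>lborel) = (\<integral>\<^sup>+z. f (\<i> * z) \<partial>lborel)"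
      by (rule main) (auto simp: complex_eq_iff)
    also have "\<dots> = (\<integral>\<^sup>+z. f z \<partial>lborel)"
      using f by (rule main) (auto simp: complex_eq_iff)
    finally show ?thesis by (simp add: True mult.assoc[symmetric])
  qed (use main f c in auto)
qed

lemma nn_integral_complex_translation:
  fixes f :: "complex \<Rightarrow> ennreal"
  assumes [measurable]: "f \<in> borel_measurable borel"
  shows "(\<integral>\<^sup>+u. f (z + u) \<partial>lborel) = (\<integral>\<^sup>+u. f u \<partial>lborel)"
proof -
  have "(\<integral>\<^sup>+u. f u \<partial>lborel) = (\<integral>\<^sup>+u. f u \<partial>distr lborel borel ((+) z))"
    by (simp add: lborel_distr_plus)
  also have "\<dots> = (\<integral>\<^sup>+u. f (z + u) \<partial>lborel)"
    by (rule nn_integral_distr) auto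
  finally show ?thesis by simp
qed

lemma emeasure_lborel_complex_ball:
  assumes "0 \<le> r"
  shows "emeasure lborel (ball (z :: complex) r) = ennreal (pi * r\<^sup>2)"
  using assms by (simp add: emeasure_ball unit_ball_vol_2)

section \<open>The area mean value inequality\<close>

text \<open>Cauchy's formula at the centre of the circle through z + u. The circle is parametrised
  as the rotation orbit of \<open>u\<close>, so that the inequality can later be integrated over
  \<open>u\<close> in the disc.\<close>

lemma holomorphic_circle_mean_le:
  assumes g: "g holomorphic_on ball z r" and u: "u \<in> ball 0 r"
  shows "ennreal (cmod (g z)) \<le> (\<integral>\<^sup>+t\<in>{0..1}. ennreal (cmod (g (z + exp (2 * of_real pi * \<i> * of_real t) * u))) \<partial>lborel)"
proof (cases "u = 0")
  case True
  then show ?thesis by (simp add: nn_integral_cmult_indicator)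
next
  case False
  define \<rho> where "\<rho> = cmod u"
  \<comment> \<open>\<open>circlepath 0 \<rho>\<close> starts at the positive real point \<rho>; the
    factor \<omega> turns this starting point into \<open>u\<close>.\<close>
  define \<omega> where "\<omega> = u / of_real \<rho>"
  define h where "h = (\<lambda>v. g (z + \<omega> * v))"
  have \<rho>: "0 < \<rho>" "\<rho> < r" using False u by (auto simp: \<rho>_def)
  have \<omega>: "cmod \<omega> = 1" using \<rho> by (simp add: \<omega>_def norm_divide \<rho>_def)
  have hol: "h holomorphic_on cball 0 \<rho>"
    unfolding h_def using \<rho> \<omega>
    by (intro holomorphic_on_compose_gen[OF _ g, unfolded o_def] holomorphic_intros)
      (auto simp: dist_norm norm_mult)
  have "((\<lambda>w. h w / (w - 0)) has_contour_integral 2 * of_real pi * \<i> * h 0) (circlepath 0 \<rho>)"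
    by (rule Cauchy_integral_circlepath_simple[OF hol]) (use \<rho> in auto)
  \<comment> \<open>The derivative of the path is 2 pi i times its position, which cancels the
    Cauchy kernel.\<close>
  then have int: "((\<lambda>t. 2 * of_real pi * \<i> * h (of_real \<rho> * exp (2 * of_real pi * \<i> * of_real t)))
      has_integral 2 * of_real pi * \<i> * h 0) {0..1}"
    unfolding has_contour_integral
    by (rule has_integral_eq[rotated])
      (use \<rho> in \<open>simp add: vector_derivative_circlepath fun_cong[OF circlepath]\<close>)
  define k where "k = (\<lambda>t::real. g (z + exp (2 * of_real pi * \<i> * of_real t) * u))"
  have k_eq: "k t = h (of_real \<rho> * exp (2 * of_real pi * \<i> * of_real t))" for t
    using \<rho> by (simp add: k_def h_def \<omega>_def mult_ac)
  have "((\<lambda>t. 2 * of_real pi * \<i> * k t) has_integral 2 * of_real pi * \<i> * g z) {0..1}"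
    using int by (simp add: k_eq h_def)
  then have k_int: "(k has_integral g z) {0..1}"
    using has_integral_mult_right[of "\<lambda>t. 2 * of_real pi * \<i> * k t" "2 * of_real pi * \<i> * g z" "{0..1}"
        "1 / (2 * of_real pi * \<i>)"] by simp
  have cont: "continuous_on {0..1} k"
    unfolding k_def
    by (rule continuous_on_compose2[OF holomorphic_on_imp_continuous_on[OF g]])
      (use \<rho> in \<open>auto intro!: continuous_intros simp: dist_norm norm_mult \<rho>_def\<close>)
  have "cmod (g z) = cmod (integral {0..1} k)"
    using k_int by (simp add: integral_unique)
  also have "\<dots> \<le> integral {0..1} (\<lambda>t. cmod (k t))"
    using cont k_int by (intro integral_norm_bound_integral integrable_continuous_real continuous_intros) auto
  finally have le: "cmod (g z) \<le> integral {0..1} (\<lambda>t. cmod (k t))" .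
  have "(\<integral>\<^sup>+t\<in>{0..1}. ennreal (cmod (k t)) \<partial>lborel) = ennreal (integral {0..1} (\<lambda>t. cmod (k t)))"
  proof (rule nn_integral_has_integral_lebesgue')
    show "((\<lambda>t. cmod (k t)) has_integral integral {0..1} (\<lambda>t. cmod (k t))) {0..1}"
      using cont by (intro integrable_integral integrable_continuous_real continuous_intros)
  qed auto
  with le show ?thesis unfolding k_def by (simp add: ennreal_leI)
qed

text \<open>Averaging over all rotations of the disc reduces the area mean to circle means
  without introducing polar coordinates.\<close>

lemma holomorphic_area_mean_le:
  assumes g: "g holomorphic_on ball z r" and r: "0 < r"
  shows "ennreal (pi * r\<^sup>2 * cmod (g z)) \<le> (\<integral>\<^sup>+w\<in>ball z r. ennreal (cmod (g w)) \<partial>lborel)"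
proof -
  define h where "h = (\<lambda>w. ennreal (cmod (g w)) * indicator (ball z r) w)"
  define e where "e = (\<lambda>t::real. exp (2 * of_real pi * \<i> * of_real t))"
  have e: "cmod (e t) = 1" for t by (simp add: e_def)
  \<comment> \<open>Nothing is known about \<open>g\<close> off the disc, so measurability is
    obtained for its cut-off by zero.\<close>
  have "(\<lambda>w. indicator (ball z r) w *\<^sub>R g w) \<in> borel_measurable borel"
    using g by (intro borel_measurable_continuous_on_indicator holomorphic_on_imp_continuous_on) auto
  then have "(\<lambda>w. ennreal (cmod (indicator (ball z r) w *\<^sub>R g w))) \<in> borel_measurable borel"
    by measurable
  also have "(\<lambda>w. ennreal (cmod (indicator (ball z r) w *\<^sub>R g w))) = h"
    by (auto simp: h_def indicator_def fun_eq_iff)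
  finally have h [measurable]: "h \<in> borel_measurable borel" .
  have pair: "(\<lambda>(t, u). h (z + e t * u) * indicator {0..1} t) \<in> borel_measurable (lborel \<Otimes>\<^sub>M lborel)"
  proof -
    have [measurable]: "(\<lambda>p. z + e (fst p) * snd p) \<in> borel_measurable (lborel \<Otimes>\<^sub>M lborel)"
      unfolding e_def by (auto simp: lborel_prod intro!: borel_measurable_continuous_onI continuous_intros)
    show ?thesis unfolding case_prod_unfold by measurable
  qed
  have "ennreal (pi * r\<^sup>2 * cmod (g z)) = (\<integral>\<^sup>+u. ennreal (cmod (g z)) * indicator (ball 0 r) u \<partial>(lborel :: complex measure))"
    using r by (subst nn_integral_cmult_indicator)
      (auto simp: emeasure_lborel_complex_ball ennreal_mult[symmetric] mult_ac)
  also have "\<dots> \<le> (\<integral>\<^sup>+u. (\<integral>\<^sup>+t. h (z + e t * u) * indicator {0..1} t \<partial>lborel) \<partial>lborel)"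
  proof (rule nn_integral_mono)
    fix u :: complex
    \<comment> \<open>Rotations preserve the disc, so the cut-off depends on \<open>u\<close> alone
      and can be taken out of the integral over \<open>t\<close>.\<close>
    have "h (z + e t * u) = ennreal (cmod (g (z + e t * u))) * indicator (ball 0 r) u" for t
      using e[of t] by (auto simp: h_def indicator_def dist_norm norm_mult)
    then show "ennreal (cmod (g z)) * indicator (ball 0 r) u
        \<le> (\<integral>\<^sup>+t. h (z + e t * u) * indicator {0..1} t \<partial>lborel)"
      using holomorphic_circle_mean_le[OF g, of u]
      by (cases "u \<in> ball 0 r") (auto simp: e_def)
  qed
  \<comment> \<open>With \<open>t\<close> fixed in the inner integral, rotation and translation
    invariance remove it from the integrand.\<close>
  also have "\<dots> = (\<integral>\<^sup>+t. (\<integral>\<^sup>+u. h (z + e t * u) * indicator {0..1} t \<partial>lborel) \<partial>lborel)"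
    by (rule lborel_pair.Fubini'[OF pair])
  also have "\<dots> = (\<integral>\<^sup>+t. (\<integral>\<^sup>+u. h u \<partial>lborel) * indicator {0..1} (t::real) \<partial>lborel)"
  proof (rule nn_integral_cong)
    fix t :: real
    have tr [measurable]: "(\<lambda>u. h (z + u)) \<in> borel_measurable borel"
      by measurable
    have "(\<lambda>u. h (z + e t * u)) \<in> borel_measurable borel"
      by measurable
    then have "(\<integral>\<^sup>+u. h (z + e t * u) * indicator {0..1} t \<partial>lborel)
        = (\<integral>\<^sup>+u. h (z + e t * u) \<partial>lborel) * indicator {0..1} t"
      by (intro nn_integral_multc) auto
    also have "(\<integral>\<^sup>+u. h (z + e t * u) \<partial>lborel) = (\<integral>\<^sup>+u. h (z + u) \<partial>lborel)"
      using nn_integral_rotation[OF tr e] by simp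
    also have "\<dots> = (\<integral>\<^sup>+u. h u \<partial>lborel)"
      by (rule nn_integral_complex_translation[OF h])
    finally show "(\<integral>\<^sup>+u. h (z + e t * u) * indicator {0..1} t \<partial>lborel)
        = (\<integral>\<^sup>+u. h u \<partial>lborel) * indicator {0..1} t" .
  qed
  also have "\<dots> = (\<integral>\<^sup>+u. h u \<partial>lborel)"
    by (subst nn_integral_cmult_indicator) auto
  finally show ?thesis by (simp add: h_def)
qed

section \<open>Bounds for the span metric\<close>

text \<open>A ball is connected, so if it contained a point of \<open>D\<close> and a point outside
  \<open>D\<close> it would meet the frontier, at less than the minimal distance from its
  centre.\<close>

lemma ball_infdist_frontier_subset:
  fixes D :: "'a :: real_normed_vector set"
  assumes "z \<in> D"
  shows "ball z (infdist z (frontier D)) \<subseteq> D"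
proof (rule ccontr)
  assume "\<not> ball z (infdist z (frontier D)) \<subseteq> D"
  then obtain w where w: "w \<in> ball z (infdist z (frontier D))" "w \<notin> D" by blast
  then have "z \<in> ball z (infdist z (frontier D))"
    by (metis centre_in_ball mem_ball zero_le_dist le_less_trans)
  with w assms have "ball z (infdist z (frontier D)) \<inter> D \<noteq> {}" "ball z (infdist z (frontier D)) - D \<noteq> {}"
    by blast+
  then have "ball z (infdist z (frontier D)) \<inter> frontier D \<noteq> {}"
    by (rule connected_Int_frontier[OF connected_ball])
  then obtain x where "x \<in> frontier D" "dist z x < infdist z (frontier D)" by auto
  with infdist_le[of x "frontier D" z] show False by simp
qed

text \<open>The area mean value inequality is applied to the square of f', whose modulus is exactly
  the energy density.\<close>

lemma deriv_le_of_energy_le: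
  assumes "open D" "ball z r \<subseteq> D" "0 < r" and f: "f holomorphic_on D"
    and energy: "(\<integral>\<^sup>+w\<in>D. ennreal ((cmod (deriv f w))\<^sup>2) \<partial>lborel) \<le> ennreal pi"
  shows "(cmod (deriv f z))\<^sup>2 \<le> (1 / r)\<^sup>2"
proof -
  have "(\<lambda>w. (deriv f w)\<^sup>2) holomorphic_on ball z r"
    using holomorphic_on_subset[OF holomorphic_deriv[OF f \<open>open D\<close>] \<open>ball z r \<subseteq> D\<close>]
    by (rule holomorphic_on_power)
  from holomorphic_area_mean_le[OF this \<open>0 < r\<close>]
  have "ennreal (pi * r\<^sup>2 * (cmod (deriv f z))\<^sup>2)
      \<le> (\<integral>\<^sup>+w\<in>ball z r. ennreal ((cmod (deriv f w))\<^sup>2) \<partial>lborel)"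
    by (simp add: norm_power)
  also have "\<dots> \<le> (\<integral>\<^sup>+w\<in>D. ennreal ((cmod (deriv f w))\<^sup>2) \<partial>lborel)"
    using \<open>ball z r \<subseteq> D\<close> by (intro nn_integral_mono mult_left_mono) (auto simp: indicator_def)
  also note energy
  finally have "pi * (r\<^sup>2 * (cmod (deriv f z))\<^sup>2) \<le> pi * 1"
    by (simp add: mult.assoc ennreal_le_iff del: mult_le_cancel_left2)
  then have "r\<^sup>2 * (cmod (deriv f z))\<^sup>2 \<le> 1"
    by (rule mult_left_le_imp_le) simp
  then show ?thesis using \<open>0 < r\<close> by (simp add: field_simps)
qed

lemma sqrt_span_metric_le:
  assumes "open D" "ball z r \<subseteq> D" "0 < r"
  shows "sqrt (span_metric D z) \<le> 1 / r"
proof -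
  have "span_metric D z \<le> (1 / r)\<^sup>2"
    unfolding span_metric_def
  proof (rule cSup_least)
    show "{(cmod (deriv f z))\<^sup>2 |f. f holomorphic_on D \<and>
        (\<integral>\<^sup>+z\<in>D. ennreal ((cmod (deriv f z))\<^sup>2) \<partial>lborel) \<le> ennreal pi} \<noteq> {}"
      by (auto intro!: exI[of _ "\<lambda>_. 0"])
  qed (use deriv_le_of_energy_le[OF assms] in blast)
  then have "sqrt (span_metric D z) \<le> sqrt ((1 / r)\<^sup>2)" by (rule real_sqrt_le_mono)
  then show ?thesis using \<open>0 < r\<close> by simp
qed

text \<open>Every admissible function gives a lower bound, once the set under the real-valued
  \<open>Sup\<close> is known to be bounded above; the disc about \<open>z\<close> supplies that
  bound.\<close>

lemma norm_deriv_le_sqrt_span_metric: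
  assumes "open D" "ball z r \<subseteq> D" "0 < r" and f: "f holomorphic_on D"
    and energy: "(\<integral>\<^sup>+w\<in>D. ennreal ((cmod (deriv f w))\<^sup>2) \<partial>lborel) \<le> ennreal pi"
  shows "cmod (deriv f z) \<le> sqrt (span_metric D z)"
proof -
  have "(cmod (deriv f z))\<^sup>2 \<le> span_metric D z"
    unfolding span_metric_def
  proof (rule cSup_upper)
    show "bdd_above {(cmod (deriv f z))\<^sup>2 |f. f holomorphic_on D \<and>
        (\<integral>\<^sup>+z\<in>D. ennreal ((cmod (deriv f z))\<^sup>2) \<partial>lborel) \<le> ennreal pi}"
      using deriv_le_of_energy_le[OF assms(1-3)] by (intro bdd_aboveI[of _ "(1 / r)\<^sup>2"]) blast
  qed (use f energy in blast)
  then show ?thesis by (rule real_le_rsqrt)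
qed

text \<open>Polar coordinates would give pi / \<rho>^2. Enlarging each dyadic annulus to a full disc
  loses the factor 16/3, which is harmless here and requires only areas of discs and a geometric
  series of ratio 1/4.\<close>

lemma nn_integral_inverse_norm_power4_le:
  assumes "0 < \<rho>"
  shows "(\<integral>\<^sup>+w\<in>- ball b \<rho>. ennreal (1 / (cmod (w - b)) ^ 4) \<partial>lborel) \<le> ennreal (16 * pi / (3 * \<rho>\<^sup>2))"
proof -
  define B where "B = (\<lambda>k::nat. ball b (2 ^ Suc k * \<rho>))"
  define c where "c = (\<lambda>k::nat. 1 / (2 ^ k * \<rho>) ^ 4)"
  \<comment> \<open>Dyadic decomposition: on the annulus of radii \<open>2\<^sup>k \<rho>\<close> and \<open>2\<^sup>k\<^sup>+\<^sup>1 \<rho>\<close> the integrand is at most \<open>c k\<close>.\<close>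
  have pw: "ennreal (1 / (cmod (w - b)) ^ 4) * indicator (- ball b \<rho>) w
      \<le> (\<Sum>k. ennreal (c k) * indicator (B k) w)" for w
  proof (cases "w \<in> ball b \<rho>")
    case False
    define s where "s = cmod (w - b)"
    have s: "\<rho> \<le> s" using False by (simp add: s_def dist_norm norm_minus_commute)
    obtain n where "s / \<rho> < 2 ^ n"
      using real_arch_pow[of 2 "s / \<rho>"] by auto
    then have n: "s < 2 ^ n * \<rho>" using assms by (simp add: field_simps)
    \<comment> \<open>The predecessor of \<open>j\<close> indexes the annulus containing
      \<open>w\<close>; it exists because \<open>w\<close> lies outside the disc of radius
      \<rho>.\<close>
    define j where "j = (LEAST n. s < 2 ^ n * \<rho>)"
    have j: "s < 2 ^ j * \<rho>" unfolding j_def by (rule LeastI, rule n)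
    with s have "j \<noteq> 0" by (intro notI) simp
    then obtain k where k: "j = Suc k" using not0_implies_Suc by blast
    then have k1: "2 ^ k * \<rho> \<le> s"
      using not_less_Least[of k "\<lambda>n. s < 2 ^ n * \<rho>"] by (simp add: j_def)
    have "w \<in> B k" using j by (simp add: B_def k s_def dist_norm norm_minus_commute)
    have "1 / s ^ 4 \<le> c k"
      unfolding c_def using k1 assms s by (intro divide_left_mono power_mono mult_pos_pos zero_less_power) auto
    then have "ennreal (1 / s ^ 4) * indicator (- ball b \<rho>) w \<le> ennreal (c k) * indicator (B k) w"
      using \<open>w \<in> B k\<close> False by (simp add: ennreal_leI)
    also have "\<dots> = (\<Sum>i\<in>{k}. ennreal (c i) * indicator (B i) w)"
      by (simp only: sum.insert finite.emptyI empty_iff not_False_eq_True sum.empty add_0_right)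
    also have "\<dots> \<le> (\<Sum>i. ennreal (c i) * indicator (B i) w)"
      by (rule sum_le_suminf) auto
    finally show ?thesis by (simp add: s_def)
  qed simp
  have "(\<integral>\<^sup>+w\<in>- ball b \<rho>. ennreal (1 / (cmod (w - b)) ^ 4) \<partial>lborel)
      \<le> (\<integral>\<^sup>+w. (\<Sum>k. ennreal (c k) * indicator (B k) w) \<partial>lborel)"
    by (intro nn_integral_mono pw)
  also have "\<dots> = (\<Sum>k. \<integral>\<^sup>+w. ennreal (c k) * indicator (B k) w \<partial>lborel)"
    by (intro nn_integral_suminf borel_measurable_times_ennreal borel_measurable_indicator) (auto simp: B_def)
  also have "\<dots> = (\<Sum>k. ennreal (4 * pi / \<rho>\<^sup>2 * (1 / 4) ^ k))"
  proof (rule suminf_cong)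
    fix k
    have "(\<integral>\<^sup>+w. ennreal (c k) * indicator (B k) w \<partial>lborel) = ennreal (c k * (pi * (2 ^ Suc k * \<rho>)\<^sup>2))"
      using assms
      by (subst nn_integral_cmult_indicator)
        (auto simp: B_def c_def emeasure_lborel_complex_ball ennreal_mult[symmetric])
    also have "c k * (pi * (2 ^ Suc k * \<rho>)\<^sup>2) = 4 * pi / \<rho>\<^sup>2 * (1 / 4) ^ k"
    proof -
      have "(4::real) ^ k = 2 ^ k * 2 ^ k"
        by (simp flip: power_mult_distrib)
      then show ?thesis using assms
        by (simp add: c_def field_simps power2_eq_square power4_eq_xxxx)
    qed
    finally show "(\<integral>\<^sup>+w. ennreal (c k) * indicator (B k) w \<partial>lborel) = ennreal (4 * pi / \<rho>\<^sup>2 * (1 / 4) ^ k)" .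
  qed
  also have "\<dots> = ennreal (16 * pi / (3 * \<rho>\<^sup>2))"
  proof (rule suminf_ennreal_eq)
    have "(\<lambda>k. 4 * pi / \<rho>\<^sup>2 * (1 / 4) ^ k) sums (4 * pi / \<rho>\<^sup>2 * (1 / (1 - 1 / 4)))"
      by (intro sums_mult geometric_sums) simp
    then show "(\<lambda>k. 4 * pi / \<rho>\<^sup>2 * (1 / 4) ^ k) sums (16 * pi / (3 * \<rho>\<^sup>2))"
      by (simp add: mult.commute)
  qed (use assms in simp)
  finally show ?thesis .
qed

lemma sqrt_span_metric_ge:
  assumes "open D" "ball z r \<subseteq> D" "0 < r" and "0 < \<rho>" and disj: "ball b \<rho> \<inter> D = {}"
  shows "\<rho> / (4 * (cmod (z - b))\<^sup>2) \<le> sqrt (span_metric D z)"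
proof -
  \<comment> \<open>With this coefficient the energy is at most (\<rho>/4)^2 times 16 pi / (3
    \<rho>^2), that is pi / 3, within the allowed pi.\<close>
  define \<kappa> where "\<kappa> = complex_of_real (\<rho> / 4)"
  define f where "f = (\<lambda>w. \<kappa> / (w - b))"
  have "b \<notin> D" using disj centre_in_ball[of b \<rho>] \<open>0 < \<rho>\<close> by blast
  have hol: "f holomorphic_on D"
    unfolding f_def using \<open>b \<notin> D\<close> by (intro holomorphic_intros) auto
  have df: "deriv f w = - \<kappa> / (w - b)\<^sup>2" if "w \<in> D" for w
  proof (rule DERIV_imp_deriv)
    have "w - b \<noteq> 0" using that \<open>b \<notin> D\<close> by auto
    then show "(f has_field_derivative - \<kappa> / (w - b)\<^sup>2) (at w)"
      unfolding f_def by (auto intro!: derivative_eq_intros simp: power2_eq_square)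
  qed
  have ndf: "cmod (deriv f w) = (\<rho> / 4) / (cmod (w - b))\<^sup>2" if "w \<in> D" for w
    using \<open>0 < \<rho>\<close> by (simp add: df[OF that] \<kappa>_def norm_divide norm_power)
  have "(\<integral>\<^sup>+w\<in>D. ennreal ((cmod (deriv f w))\<^sup>2) \<partial>lborel)
      \<le> (\<integral>\<^sup>+w. ennreal ((\<rho> / 4)\<^sup>2) * (ennreal (1 / (cmod (w - b)) ^ 4) * indicator (- ball b \<rho>) w) \<partial>lborel)"
  proof (rule nn_integral_mono)
    fix w
    show "ennreal ((cmod (deriv f w))\<^sup>2) * indicator D w
        \<le> ennreal ((\<rho> / 4)\<^sup>2) * (ennreal (1 / (cmod (w - b)) ^ 4) * indicator (- ball b \<rho>) w)"
    proof (cases "w \<in> D")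
      case True
      then have "w \<in> - ball b \<rho>" using disj by auto
      moreover have "(cmod (deriv f w))\<^sup>2 = (\<rho> / 4)\<^sup>2 * (1 / (cmod (w - b)) ^ 4)"
        by (simp add: ndf[OF True] power_divide power_mult[symmetric])
      ultimately show ?thesis using True by (simp add: ennreal_mult[symmetric])
    qed simp
  qed
  also have "\<dots> = ennreal ((\<rho> / 4)\<^sup>2) * (\<integral>\<^sup>+w\<in>- ball b \<rho>. ennreal (1 / (cmod (w - b)) ^ 4) \<partial>lborel)"
    by (rule nn_integral_cmult) measurable
  also have "\<dots> \<le> ennreal ((\<rho> / 4)\<^sup>2) * ennreal (16 * pi / (3 * \<rho>\<^sup>2))"
    by (intro mult_left_mono nn_integral_inverse_norm_power4_le) (use \<open>0 < \<rho>\<close> in auto)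
  also have "\<dots> = ennreal (pi / 3)"
    using \<open>0 < \<rho>\<close> by (simp add: ennreal_mult[symmetric] power2_eq_square)
  also have "\<dots> \<le> ennreal pi" by (intro ennreal_leI) simp
  finally have "cmod (deriv f z) \<le> sqrt (span_metric D z)"
    using norm_deriv_le_sqrt_span_metric[OF assms(1-3) hol] by simp
  moreover have "z \<in> D" using assms(2) centre_in_ball[of z r] \<open>0 < r\<close> by blast
  ultimately show ?thesis by (simp add: ndf)
qed

section \<open>Exterior discs at smooth boundary points\<close>

text \<open>Near \<open>p\<close> the defining function differs from its linear part at
  \<open>p\<close> by a function with small Lipschitz constant. Hence one outward direction
  \<open>n\<close> and one ratio \<open>c\<close> serve all nearby boundary points and all small
  scales \<open>d\<close>: the linear part is large on the disc and dominates the error, so the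
  defining function is positive there.\<close>

lemma C2_smooth_boundary_point_exterior_balls:
  assumes "C2_smooth_boundary_point D p"
  obtains c n \<delta> where "0 < c" "c \<le> 1" "cmod n = 1" "0 < \<delta>"
    "\<And>q d. q \<in> frontier D \<Longrightarrow> dist p q < \<delta> \<Longrightarrow> 0 < d \<Longrightarrow> d < \<delta> \<Longrightarrow>
       ball (q + of_real d * n) (c * d) \<inter> D = {}"
proof -
  from assms obtain U \<psi> where p: "p \<in> frontier D" and U: "open U" "p \<in> U" and C2: "C2_on U \<psi>"
    and in_D: "U \<inter> D = {z \<in> U. \<psi> z < 0}"
    and in_fr: "U \<inter> frontier D = {z \<in> U. \<psi> z = 0}"
    and nz: "\<forall>z \<in> U \<inter> frontier D. frechet_derivative \<psi> (at z) \<noteq> (\<lambda>_. 0)"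
    unfolding C2_smooth_boundary_point_def by blast
  from C2 obtain D1 :: "complex \<Rightarrow> (complex \<Rightarrow>\<^sub>L real)" and D2 :: "complex \<Rightarrow> (complex \<Rightarrow>\<^sub>L complex \<Rightarrow>\<^sub>L real)"
    where D1: "\<And>z. z \<in> U \<Longrightarrow> (\<psi> has_derivative blinfun_apply (D1 z)) (at z)"
      and D2: "\<And>z. z \<in> U \<Longrightarrow> (D1 has_derivative blinfun_apply (D2 z)) (at z)"
    unfolding C2_on_def by blast
  define L where "L = D1 p"
  have "blinfun_apply L \<noteq> (\<lambda>_. 0)"
    using nz p U frechet_derivative_at[OF D1[OF U(2)]] by (auto simp: L_def)
  then obtain v where v: "L v \<noteq> 0" by auto
  then have "v \<noteq> 0" by (metis blinfun.zero_right)
  \<comment> \<open>The sign makes the defining function increase along \<open>n\<close>, so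
    \<open>n\<close> points out of \<open>D\<close>.\<close>
  define n where "n = (sgn (L v) / cmod v) *\<^sub>R v"
  define m where "m = L n"
  have n: "cmod n = 1"
    using v \<open>v \<noteq> 0\<close> by (simp add: n_def abs_sgn_eq)
  have "m = \<bar>L v\<bar> / cmod v"
    by (simp add: m_def n_def blinfun.scaleR_right abs_sgn[of "L v"] mult.commute)
  then have m: "0 < m" using v \<open>v \<noteq> 0\<close> by simp
  \<comment> \<open>A deviation of size \<open>c * d\<close> then changes \<open>L\<close> by at
    most m d / 4, and \<open>c \<le> 1\<close> keeps the disc within distance 2 d of
    \<open>q\<close>. Adding 1 keeps the denominator positive.\<close>
  define c where "c = min 1 (m / 4 / (norm L + 1))"
  have L1: "0 < norm L + 1" by (simp add: add_nonneg_pos)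
  have c: "0 < c" "c \<le> 1" using m L1 by (auto simp: c_def)
  have "norm L * c \<le> (norm L + 1) * (m / 4 / (norm L + 1))"
    using c by (intro mult_mono) (auto simp: c_def)
  also have "\<dots> = m / 4"
    using L1 by (metis less_irrefl nonzero_mult_div_cancel_left times_divide_eq_right)
  finally have Lc: "norm L * c \<le> m / 4" .
  have "isCont D1 p"
    using D2[OF U(2)] has_derivative_continuous by blast
  then obtain R1 where R1: "0 < R1" "\<And>w. dist w p < R1 \<Longrightarrow> dist (D1 w) L < m / 8"
    using m unfolding continuous_at_eps_delta L_def by (metis divide_pos_pos zero_less_numeral)
  obtain R2 where R2: "0 < R2" "ball p R2 \<subseteq> U"
    using U open_contains_ball by blast
  define R where "R = min R1 R2"
  have R: "0 < R" "ball p R \<subseteq> U" "\<And>w. w \<in> ball p R \<Longrightarrow> norm (D1 w - L) \<le> m / 8"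
    using R1 R2 by (auto simp: R_def dist_norm[symmetric] dist_commute less_imp_le)
  \<comment> \<open>Mean value inequality on a convex ball, where the derivative of \<psi> - L has
    norm at most m / 8.\<close>
  have lip: "norm ((\<psi> x - L x) - (\<psi> y - L y)) \<le> m / 8 * norm (x - y)"
    if "x \<in> ball p R" "y \<in> ball p R" for x y
  proof (rule differentiable_bound[where S = "ball p R" and f' = "\<lambda>w. blinfun_apply (D1 w - L)"])
    fix w assume w: "w \<in> ball p R"
    have "(\<psi> has_derivative blinfun_apply (D1 w)) (at w within ball p R)"
      using D1 R w by (meson has_derivative_at_withinI subsetD)
    then show "((\<lambda>x. \<psi> x - L x) has_derivative blinfun_apply (D1 w - L)) (at w within ball p R)"
      by (auto intro!: derivative_eq_intros simp: blinfun.diff_left)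
    show "onorm (blinfun_apply (D1 w - L)) \<le> m / 8"
      using R(3)[OF w] by (simp add: norm_blinfun.rep_eq)
  qed (use that in auto)
  show ?thesis
  \<comment> \<open>A point of the exterior disc is within 2 d < R / 2 of \<open>q\<close>, which is
    within R / 4 of \<open>p\<close>; it therefore stays in \<open>ball p R\<close>.\<close>
  proof (rule that[OF c n, of "R / 4"])
    show "0 < R / 4" using R by simp
    fix q d
    assume q: "q \<in> frontier D" "dist p q < R / 4" and d: "0 < d" "d < R / 4"
    have "w \<notin> D" if w: "w \<in> ball (q + of_real d * n) (c * d)" for w
    proof -
      define x where "x = w - q"
      define y where "y = x - d *\<^sub>R n"
      have y: "norm y < c * d"
        using w by (simp add: y_def x_def dist_norm norm_minus_commute scaleR_conv_of_real algebra_simps)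
      have x_eq: "x = d *\<^sub>R n + y" by (simp add: y_def)
      have "c * d \<le> 1 * d" using c d by (intro mult_right_mono) auto
      moreover have "norm x \<le> d + norm y"
        using norm_triangle_ineq[of "d *\<^sub>R n" y] n d by (simp add: x_eq)
      ultimately have x: "norm x \<le> 2 * d" using y by linarith
      have qR: "q \<in> ball p R" using q(2) R by simp
      have wR: "w \<in> ball p R"
        using dist_triangle[of p w q] q(2) d x R by (simp add: x_def dist_norm norm_minus_commute)
      have "\<bar>L y\<bar> \<le> norm L * norm y" using norm_blinfun[of L y] by simp
      also have "\<dots> \<le> norm L * (c * d)" using y by (intro mult_left_mono) auto
      also have "\<dots> = (norm L * c) * d" by simp
      also have "\<dots> \<le> m / 4 * d" using Lc d by (intro mult_right_mono) auto
      finally have "L y \<ge> - (m / 4 * d)" by linarith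
      then have Lx: "L x \<ge> 3 / 4 * (m * d)"
        by (simp add: x_eq blinfun.add_right blinfun.scaleR_right m_def[symmetric] algebra_simps)
      have "\<psi> q = 0" using in_fr q(1) qR R(2) by blast
      then have "\<bar>\<psi> w - L x\<bar> \<le> m / 8 * norm x"
        using lip[OF wR qR] by (simp add: x_def blinfun.diff_right algebra_simps)
      also have "\<dots> \<le> m / 8 * (2 * d)" using x m by (intro mult_left_mono) auto
      \<comment> \<open>The linear part contributes at least 3/4 m d and the error at most 1/4 m
        d.\<close>
      finally have "\<psi> w \<ge> m * d / 2" using Lx by (simp add: abs_if algebra_simps split: if_splits)
      moreover have "m * d > 0" using m d by simp
      ultimately have "\<not> \<psi> w < 0" by simp
      then show ?thesis using in_D wR R(2) by blast
    qed
    then show "ball (q + of_real d * n) (c * d) \<inter> D = {}" by blast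
  qed
qed

section \<open>Two-sided comparison with the boundary distance near \<open>p\<close>\<close>

theorem theorem1p1:
  fixes D :: "complex set" and p :: complex
  assumes "domain_bounded_by_jordan_curves D" and "bounded D"
    and "C2_smooth_boundary_point D p"
  shows "\<exists>C>1. \<exists>V. open V \<and> p \<in> V \<and>
           (\<forall>z\<in>V \<inter> D.
              1 / C * (1 / infdist z (frontier D)) \<le> sqrt (span_metric D z) \<and>
              sqrt (span_metric D z) \<le> C * (1 / infdist z (frontier D)))"
proof -
  have D: "open D"
    using assms(1) by (simp add: domain_bounded_by_jordan_curves_def)
  have p: "p \<in> frontier D"
    using assms(3) by (simp add: C2_smooth_boundary_point_def)
  obtain c n \<delta> where c: "0 < c" "c \<le> 1" and n: "cmod n = 1" and \<delta>: "0 < \<delta>"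
    and ext: "\<And>q d. q \<in> frontier D \<Longrightarrow> dist p q < \<delta> \<Longrightarrow> 0 < d \<Longrightarrow> d < \<delta> \<Longrightarrow>
       ball (q + of_real d * n) (c * d) \<inter> D = {}"
    using C2_smooth_boundary_point_exterior_balls[OF assms(3)] by blast
  \<comment> \<open>The lower estimate below is c d / (4 (2 d)^2) = c / (16 d), which dictates the
    constant; being above 1, it also covers the upper estimate 1 / d.\<close>
  have C: "16 / c > 1" using c by simp
  have "1 / (16 / c) * (1 / infdist z (frontier D)) \<le> sqrt (span_metric D z) \<and>
      sqrt (span_metric D z) \<le> 16 / c * (1 / infdist z (frontier D))"
    if z: "z \<in> ball p (\<delta> / 2) \<inter> D" for z
  proof -
    define d where "d = infdist z (frontier D)"
    have "z \<notin> frontier D" using z D by (auto simp: frontier_def interior_open)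
    then have d: "0 < d"
      using p infdist_pos_not_in_closed[of "frontier D" z] by (auto simp: d_def)
    obtain q where q: "q \<in> frontier D" "d = dist z q"
      using infdist_attains_inf[of "frontier D" z] p by (auto simp: d_def)
    have d_le: "d < \<delta> / 2"
      using infdist_le[OF p, of z] z by (simp add: d_def dist_commute)
    have sub: "ball z d \<subseteq> D"
      using ball_infdist_frontier_subset[of z D] z by (simp add: d_def)
    define b where "b = q + of_real d * n"
    \<comment> \<open>Halving \<delta> for the neighbourhood pays for both legs of the path from
      \<open>p\<close> through \<open>z\<close> to \<open>q\<close>.\<close>
    have "dist p q < \<delta>"
      using dist_triangle[of p q z] d_le q z by simp
    then have disj: "ball b (c * d) \<inter> D = {}"
      using ext q d d_le \<delta> by (simp add: b_def)
    have "cmod (z - b) \<le> 2 * d"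
      using norm_triangle_ineq4[of "z - q" "of_real d * n"] q d n
      by (simp add: b_def dist_norm norm_mult algebra_simps)
    \<comment> \<open>Needed for monotonicity of the quotient: at \<open>z = b\<close> its
      right-hand side would be a division by zero, hence 0.\<close>
    moreover have "z \<noteq> b"
      using disj centre_in_ball[of b "c * d"] mult_pos_pos[OF c(1) d] z by blast
    ultimately have "c * d / (4 * (2 * d)\<^sup>2) \<le> c * d / (4 * (cmod (z - b))\<^sup>2)"
      using c d by (intro divide_left_mono mult_left_mono power_mono mult_pos_pos) auto
    also have "\<dots> \<le> sqrt (span_metric D z)"
      using sqrt_span_metric_ge[OF D sub d _ disj] c d by simp
    finally have lower: "c / 16 * (1 / d) \<le> sqrt (span_metric D z)"
      using d by (simp add: power2_eq_square)
    have "1 / d \<le> 16 / c * (1 / d)"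
      using C d by (simp add: field_simps)
    with sqrt_span_metric_le[OF D sub d] lower show ?thesis
      by (simp add: d_def)
  qed
  then show ?thesis using C \<delta>
    by (intro exI[of _ "16 / c"] conjI exI[of _ "ball p (\<delta> / 2)"]) auto
qed

end
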